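(* Let $Q$ be a reduced rooted tree poset and let $P$ be an inflation of $Q$ with map $\varphi:P\to Q$, and assume $|P|\ge 2$. Let $\ell_1,\dots,\ell_s$ be the leaves (minimal elements) of $Q$, and for each $i$ let $u_{i,0},\dots,u_{i,\omega(i)}$, $b_{i,j}$, $c_{i,j}$ be as defined in the context. Then the number of tangled labelings of $P$ is \[(n-1)!\sum_{i=1}^s\prod_{j=1}^{\omega(i)}\frac{b_{i,j}-1}{c_{i,j}-1},\] where $n=\sum_{v\in Q}|\varphi^{-1}(v)|=|P|$.
   Context: A rooted tree poset is a finite connected poset in which each element is covered by at most one other element (so its Hasse diagram is a rooted tree whose root is the unique maximal element). It is reduced if no element covers exactly one element. An inflation of a finite poset $Q$ is a poset $P$ together with a surjective map $\varphi:P\to Q$ such that (1) for each $v\in Q$, the subposet $\varphi^{-1}(v)$ has a unique minimal element, and (2) if $\varphi(x)\ne\varphi(y)$ then $x<_P y$ iff $\varphi(x)<_Q\varphi(y)$. For each leaf $\ell_i$ of $Q$, let $u_{i,0}=\ell_i,u_{i,1},\dots,u_{i,\omega(i)}$ be the path in the Hasse diagram from $\ell_i$ to the root, with $u_{i,j}$ covering $u_{i,j-1}$ and $u_{i,\omega(i)}$ the root. Define $b_{i,j}=\sum_{v\le_Q u_{i,j-1}}|\varphi^{-1}(v)|$ and $c_{i,j}=\sum_{v<_Q u_{i,j}}|\varphi^{-1}(v)|$. A labeling of an $n$-element poset $P$ is a bijection $L:P\to[n]$; a linear extension is a labeling with $L(x)\le L(y)$ whenever $x\le_P y$. For a labeling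 $L$ and a non-maximal $x$, the $L$-successor of $x$ is the element $y>_P x$ minimizing $L(y)$. The promotion chain of $L$ is $v_1<_P\cdots<_P v_m$ with $v_1=L^{-1}(1)$, $v_{i+1}$ the $L$-successor of $v_i$ while $v_i$ is not maximal, and $v_m$ maximal. Extended promotion: $\partial(L)(x)=L(x)-1$ for $x$ not in the chain, $\partial(L)(v_i)=L(v_{i+1})-1$ for $i<m$, $\partial(L)(v_m)=n$. A labeling $L$ is tangled if $n\ge2$ and $\partial^{n-2}(L)$ is not a linear extension. An empty product equals $1$. *)

theory Defs
  imports Complex_Main "HOL-Library.FuncSet"
begin

definition finite_poset :: "'a set \<Rightarrow> 'a rel \<Rightarrow> bool" where
  "finite_poset P r \<longleftrightarrow> finite P \<and> partial_order_on P r"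

definition strict_below :: "'a rel \<Rightarrow> 'a \<Rightarrow> 'a \<Rightarrow> bool" where
  "strict_below r x y \<longleftrightarrow> (x, y) \<in> r \<and> x \<noteq> y"

definition covers :: "'a set \<Rightarrow> 'a rel \<Rightarrow> 'a \<Rightarrow> 'a \<Rightarrow> bool" where
  "covers P r y x \<longleftrightarrow> x \<in> P \<and> y \<in> P \<and> strict_below r x y \<and>
     \<not> (\<exists>z\<in>P. strict_below r x z \<and> strict_below r z y)"

definition minimal_elements :: "'a set \<Rightarrow> 'a rel \<Rightarrow> 'a set" where
  "minimal_elements P r = {x \<in> P. \<not> (\<exists>y\<in>P. strict_below r y x)}"

definition maximal_elements :: "'a set \<Rightarrow> 'a rel \<Rightarrow> 'a set" where
  "maximal_elements P r = {x \<in> P. \<not> (\<exists>y\<in>P. strict_below r x y)}"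

definition hasse_edges :: "'a set \<Rightarrow> 'a rel \<Rightarrow> 'a rel" where
  "hasse_edges P r = {(x, y). covers P r x y \<or> covers P r y x}"

definition connected_poset :: "'a set \<Rightarrow> 'a rel \<Rightarrow> bool" where
  "connected_poset P r \<longleftrightarrow> P \<noteq> {} \<and> (\<forall>x\<in>P. \<forall>y\<in>P. (x, y) \<in> (hasse_edges P r)\<^sup>*)"

definition rooted_tree_poset :: "'a set \<Rightarrow> 'a rel \<Rightarrow> bool" where
  "rooted_tree_poset P r \<longleftrightarrow> finite_poset P r \<and> connected_poset P r \<and>
     (\<forall>x\<in>P. card {y \<in> P. covers P r y x} \<le> 1)"

definition reduced_poset :: "'a set \<Rightarrow> 'a rel \<Rightarrow> bool" where
  "reduced_poset P r \<longleftrightarrow> (\<forall>x\<in>P. card {y \<in> P. covers P r x y} \<noteq> 1)"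

definition is_root :: "'a set \<Rightarrow> 'a rel \<Rightarrow> 'a \<Rightarrow> bool" where
  "is_root P r x \<longleftrightarrow> maximal_elements P r = {x}"

definition fiber :: "'p set \<Rightarrow> ('p \<Rightarrow> 'q) \<Rightarrow> 'q \<Rightarrow> 'p set" where
  "fiber P \<phi> v = {x \<in> P. \<phi> x = v}"

definition inflation :: "'p set \<Rightarrow> 'p rel \<Rightarrow> 'q set \<Rightarrow> 'q rel \<Rightarrow> ('p \<Rightarrow> 'q) \<Rightarrow> bool" where
  "inflation P rP Q rQ \<phi> \<longleftrightarrow> finite_poset P rP \<and> finite_poset Q rQ \<and> \<phi> ` P = Q \<and>
     (\<forall>v\<in>Q. \<exists>!x. x \<in> minimal_elements (fiber P \<phi> v) rP) \<and>
     (\<forall>x\<in>P. \<forall>y\<in>P. \<phi> x \<noteq> \<phi> y \<longrightarrow> (strict_below rP x y \<longleftrightarrow> strict_below rQ (\<phi> x) (\<phi> y)))"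

definition path_to_root :: "'q set \<Rightarrow> 'q rel \<Rightarrow> 'q \<Rightarrow> (nat \<Rightarrow> 'q) \<Rightarrow> nat \<Rightarrow> bool" where
  "path_to_root Q r x w m \<longleftrightarrow> w 0 = x \<and> (\<forall>j\<in>{1..m}. covers Q r (w j) (w (j - 1))) \<and>
     is_root Q r (w m)"

definition b_num ::
  "'p set \<Rightarrow> 'q set \<Rightarrow> 'q rel \<Rightarrow> ('p \<Rightarrow> 'q) \<Rightarrow> (nat \<Rightarrow> nat \<Rightarrow> 'q) \<Rightarrow> nat \<Rightarrow> nat \<Rightarrow> nat" where
  "b_num P Q rQ \<phi> u i j = (\<Sum>v\<in>{v \<in> Q. (v, u i (j - 1)) \<in> rQ}. card (fiber P \<phi> v))"

definition c_num ::
  "'p set \<Rightarrow> 'q set \<Rightarrow> 'q rel \<Rightarrow> ('p \<Rightarrow> 'q) \<Rightarrow> (nat \<Rightarrow> nat \<Rightarrow> 'q) \<Rightarrow> nat \<Rightarrow> nat \<Rightarrow> nat" where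
  "c_num P Q rQ \<phi> u i j = (\<Sum>v\<in>{v \<in> Q. strict_below rQ v (u i j)}. card (fiber P \<phi> v))"

text \<open>
  Labelings are extensional, i.e. equal to \<^term>\<open>undefined\<close> off the poset, so that the set of
  labelings can be counted; for the same reason promotion below is restricted to the poset.
\<close>

definition labelings :: "'a set \<Rightarrow> ('a \<Rightarrow> nat) set" where
  "labelings P = {L \<in> extensional P. bij_betw L P {1..card P}}"

definition linear_extension :: "'a set \<Rightarrow> 'a rel \<Rightarrow> ('a \<Rightarrow> nat) \<Rightarrow> bool" where
  "linear_extension P r L \<longleftrightarrow> L \<in> labelings P \<and>
     (\<forall>x\<in>P. \<forall>y\<in>P. (x, y) \<in> r \<longrightarrow> L x \<le> L y)"

definition label_successor :: "'a set \<Rightarrow> 'a rel \<Rightarrow> ('a \<Rightarrow> nat) \<Rightarrow> 'a \<Rightarrow> 'a" where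
  "label_successor P r L x = (ARG_MIN L y. y \<in> P \<and> strict_below r x y)"

text \<open>
  The promotion chain as a set; its order is recovered by \<^const>\<open>label_successor\<close>.
\<close>

inductive_set promotion_chain :: "'a set \<Rightarrow> 'a rel \<Rightarrow> ('a \<Rightarrow> nat) \<Rightarrow> 'a set"
  for P :: "'a set" and r :: "'a rel" and L :: "'a \<Rightarrow> nat" where
  start: "inv_into P L 1 \<in> promotion_chain P r L"
| step: "x \<in> promotion_chain P r L \<Longrightarrow> x \<notin> maximal_elements P r \<Longrightarrow>
    label_successor P r L x \<in> promotion_chain P r L"

definition promotion :: "'a set \<Rightarrow> 'a rel \<Rightarrow> ('a \<Rightarrow> nat) \<Rightarrow> 'a \<Rightarrow> nat" where
  "promotion P r L = (\<lambda>x\<in>P.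
     if x \<notin> promotion_chain P r L then L x - 1
     else if x \<in> maximal_elements P r then card P
     else L (label_successor P r L x) - 1)"

definition tangled :: "'a set \<Rightarrow> 'a rel \<Rightarrow> ('a \<Rightarrow> nat) \<Rightarrow> bool" where
  "tangled P r L \<longleftrightarrow> L \<in> labelings P \<and> card P \<ge> 2 \<and>
     \<not> linear_extension P r ((promotion P r ^^ (card P - 2)) L)"

end

theory Submission
  imports Defs "HOL-Combinatorics.Permutations"
begin

text \<open>
  Follow labels as tokens that lose \<open>1\<close> at every promotion. After \<open>k\<close> promotions the \<open>k\<close> largest
  labels are sorted and occupy an up-set. Hence \<open>L\<close> is tangled iff, after \<open>n - 2\<close> promotions, the
  token \<open>n\<close> (now \<open>2\<close>) is below the token \<open>n - 1\<close> (now \<open>1\<close>); this forces token \<open>n\<close> to sit at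
  a minimal element \<open>x\<close> from the beginning, i.e. at the bottom of the fiber of a leaf of \<open>Q\<close>.

  Let \<open>v\<close> cover \<open>w\<close> on the path from that leaf to the root, let \<open>D\<close> be the preimage of the elements
  strictly below \<open>v\<close> and \<open>C\<close> that of the elements weakly below \<open>w\<close>. What happens outside \<open>D\<close> does
  not depend on how the labels are arranged inside \<open>D\<close>. Whenever a token drops into \<open>D\<close>, it lands
  in the component of \<open>D\<close> where the label \<open>1\<close> was. So the component in which token \<open>n - 1\<close> ends
  up is the initial component of a token that is determined by the labels outside \<open>D\<close>, and the
  initial place of the latter is uniformly distributed in \<open>D - {x}\<close>. This yields the factor
  \<open>(|C| - 1) / (|D| - 1)\<close>, and the factors telescope along the path.
\<close>

section \<open>Promotion on a finite poset\<close>

lemma finite_labelings: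
  assumes "finite P"
  shows "finite (labelings P)"
proof -
  have "labelings P \<subseteq> P \<rightarrow>\<^sub>E {1..card P}"
    by (auto simp: labelings_def bij_betw_def PiE_def)
  then show ?thesis
    using assms by (meson finite_PiE finite_atLeastAtMost finite_subset)
qed

lemma labeling_transpose:
  assumes "L \<in> labelings P" "y \<in> P" "z \<in> P"
  shows "L \<circ> transpose y z \<in> labelings P"
proof -
  have "transpose y z permutes P"
    using assms by (simp add: permutes_swap_id)
  then have "bij_betw (transpose y z) P P"
    by (rule permutes_imp_bij)
  then have "bij_betw (L \<circ> transpose y z) P {1..card P}"
    using assms by (intro bij_betw_trans) (auto simp: labelings_def)
  moreover have "L \<circ> transpose y z \<in> extensional P"
    using assms by (auto simp: labelings_def extensional_def transpose_def)
  ultimately show ?thesis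
    by (simp add: labelings_def)
qed

text \<open>Composing one fixed labeling \<open>K\<close> that has its top label at \<open>x\<close>
  with the permutations of \<open>P - {x}\<close> gives each such labeling exactly once.\<close>

lemma card_labelings_fixed_top:
  assumes "finite P" "x \<in> P"
  shows "card {L \<in> labelings P. L x = card P} = fact (card P - 1)"
proof -
  let ?n = "card P"
  have npos: "?n \<ge> 1"
    using assms by (metis One_nat_def Suc_leI card_gt_0_iff empty_iff)
  obtain h where h: "bij_betw h (P - {x}) {1..?n - 1}"
    using assms finite_same_card_bij[of "P - {x}" "{1..?n - 1}"] by auto
  define K where "K = (\<lambda>y. if y = x then ?n else if y \<in> P then h y else undefined)"
  have "bij_betw K (P - {x}) {1..?n - 1}"
    using h by (rule bij_betw_cong[THEN iffD1, rotated]) (auto simp: K_def)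
  moreover have "bij_betw K {x} {?n}"
    by (simp add: K_def bij_betw_def)
  ultimately have "bij_betw K ((P - {x}) \<union> {x}) ({1..?n - 1} \<union> {?n})"
    by (rule bij_betw_combine) auto
  moreover have "(P - {x}) \<union> {x} = P" "{1..?n - 1} \<union> {?n} = {1..?n}"
    using assms npos by auto
  ultimately have K: "bij_betw K P {1..?n}"
    by simp
  have Kx: "K x = ?n"
    by (simp add: K_def)
  have Kinv: "K (inv_into P K k) = k" "inv_into P K k \<in> P" if "k \<in> {1..?n}" for k
    using K that by (auto simp: bij_betw_def f_inv_into_f inv_into_into)
  have Kinj: "inj_on K P"
    using K by (simp add: bij_betw_def)
  have Kext: "K \<in> extensional P"
    using assms by (auto simp: K_def extensional_def)
  have "bij_betw (\<lambda>p. K \<circ> p) {p. p permutes (P - {x})} {L \<in> labelings P. L x = ?n}"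
  proof (rule bij_betw_imageI)
    show "inj_on (\<lambda>p. K \<circ> p) {p. p permutes (P - {x})}"
    proof (rule inj_onI, rule ext)
      fix p q y
      assume p: "p \<in> {p. p permutes (P - {x})}" and q: "q \<in> {p. p permutes (P - {x})}"
        and eq: "K \<circ> p = K \<circ> q"
      have pP: "p permutes P" "q permutes P"
        using p q permutes_subset[of _ "P - {x}" P] by auto
      show "p y = q y"
      proof (cases "y \<in> P")
        case True
        then have "p y \<in> P" "q y \<in> P"
          using pP permutes_in_image by fastforce+
        moreover have "K (p y) = K (q y)"
          using eq by (metis comp_apply)
        ultimately show ?thesis
          using Kinj by (auto dest: inj_onD)
      next
        case False
        then show ?thesis
          using pP by (simp add: permutes_not_in)
      qed
    qed
    show "(\<lambda>p. K \<circ> p) ` {p. p permutes (P - {x})} = {L \<in> labelings P. L x = ?n}"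
    proof (intro equalityI subsetI)
      fix L assume "L \<in> (\<lambda>p. K \<circ> p) ` {p. p permutes (P - {x})}"
      then obtain p where p: "p permutes (P - {x})" and L: "L = K \<circ> p"
        by auto
      have pP: "p permutes P"
        using p permutes_subset[of p "P - {x}" P] by auto
      have "bij_betw L P {1..?n}"
        using bij_betw_trans[OF permutes_imp_bij[OF pP] K] by (simp add: L)
      moreover have "L \<in> extensional P"
        using Kext pP by (auto simp: L extensional_def permutes_not_in)
      moreover have "L x = ?n"
        using p by (simp add: L permutes_not_in Kx)
      ultimately show "L \<in> {L \<in> labelings P. L x = ?n}"
        by (simp add: labelings_def)
    next
      fix L assume "L \<in> {L \<in> labelings P. L x = ?n}"
      then have L: "bij_betw L P {1..?n}" "L \<in> extensional P" "L x = ?n"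
        by (auto simp: labelings_def)
      define p where "p = (\<lambda>y. if y \<in> P then inv_into P K (L y) else y)"
      have "bij_betw (inv_into P K \<circ> L) P P"
        using bij_betw_trans[OF L(1) bij_betw_inv_into[OF K]] .
      then have "bij_betw p P P"
        by (rule bij_betw_cong[THEN iffD1, rotated]) (auto simp: p_def)
      then have "p permutes P"
        by (rule bij_imp_permutes) (auto simp: p_def)
      moreover have "p x = x"
        using assms L(3) Kx Kinj by (metis inv_into_f_f p_def)
      ultimately have "p permutes (P - {x})"
        by (auto intro: permutes_superset)
      moreover have "L = K \<circ> p"
      proof
        fix y
        show "L y = (K \<circ> p) y"
        proof (cases "y \<in> P")
          case True
          then have "L y \<in> {1..?n}"
            using L(1) by (auto simp: bij_betw_def)
          then show ?thesis
            using True Kinv by (simp add: p_def)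
        next
          case False
          then show ?thesis
            using L(2) Kext by (auto simp: p_def extensional_def)
        qed
      qed
      ultimately show "L \<in> (\<lambda>p. K \<circ> p) ` {p. p permutes (P - {x})}"
        by auto
    qed
  qed
  from bij_betw_same_card[OF this] show ?thesis
    using assms card_permutations[of "P - {x}" "?n - 1"] by simp
qed

section \<open>Finite posets, label successors and a single promotion\<close>

locale promotion_poset =
  fixes P :: "'a set" and r :: "'a rel"
  assumes finite_poset: "finite_poset P r"
begin

abbreviation less (infix "\<sqsubset>" 50) where "x \<sqsubset> y \<equiv> strict_below r x y"

lemma finite_carrier: "finite P"
  using finite_poset by (simp add: finite_poset_def)

lemma less_carrier: "x \<sqsubset> y \<Longrightarrow> x \<in> P" "x \<sqsubset> y \<Longrightarrow> y \<in> P"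
  using finite_poset
  by (auto simp: finite_poset_def partial_order_on_def preorder_on_def strict_below_def)

lemma less_irrefl: "\<not> x \<sqsubset> x"
  by (simp add: strict_below_def)

lemma less_trans: "x \<sqsubset> y \<Longrightarrow> y \<sqsubset> z \<Longrightarrow> x \<sqsubset> z"
  using finite_poset
  unfolding finite_poset_def partial_order_on_def preorder_on_def strict_below_def
  by (metis antisymD transD)

lemma le_iff: "x \<in> P \<Longrightarrow> (x, y) \<in> r \<longleftrightarrow> x = y \<or> x \<sqsubset> y"
  using finite_poset
  unfolding finite_poset_def partial_order_on_def preorder_on_def strict_below_def refl_on_def
  by blast

lemma ex_maximal_above:
  assumes "S \<subseteq> P" "a \<in> S"
  obtains m where "m \<in> S" "a = m \<or> a \<sqsubset> m" "\<And>z. z \<in> S \<Longrightarrow> \<not> m \<sqsubset> z"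
proof -
  let ?T = "{z \<in> S. a = z \<or> a \<sqsubset> z}"
  have "\<exists>m\<in>?T. \<forall>z\<in>?T. z \<noteq> m \<longrightarrow> \<not> m \<sqsubset> z"
  proof (rule Finite_Set.bex_max_element)
    show "finite ?T"
      using finite_subset[OF assms(1) finite_carrier] by simp
    show "asymp_on ?T (\<sqsubset>)"
      by (rule asymp_onI) (metis less_irrefl less_trans)
    show "transp_on ?T (\<sqsubset>)"
      by (rule transp_onI) (metis less_trans)
    show "?T \<noteq> {}"
      using assms by auto
  qed
  then obtain m where m: "m \<in> S" "a = m \<or> a \<sqsubset> m" "\<forall>z\<in>?T. z \<noteq> m \<longrightarrow> \<not> m \<sqsubset> z"
    by auto
  have "\<not> m \<sqsubset> z" if "z \<in> S" for z
    using m that less_irrefl less_trans by (metis (mono_tags, lifting) mem_Collect_eq)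
  with m show ?thesis
    using that by blast
qed

lemma ex_minimal_below:
  assumes "S \<subseteq> P" "a \<in> S"
  obtains m where "m \<in> S" "m = a \<or> m \<sqsubset> a" "\<And>z. z \<in> S \<Longrightarrow> \<not> z \<sqsubset> m"
proof -
  let ?T = "{z \<in> S. z = a \<or> z \<sqsubset> a}"
  have "\<exists>m\<in>?T. \<forall>z\<in>?T. z \<noteq> m \<longrightarrow> \<not> z \<sqsubset> m"
  proof (rule Finite_Set.bex_min_element)
    show "finite ?T"
      using finite_subset[OF assms(1) finite_carrier] by simp
    show "asymp_on ?T (\<sqsubset>)"
      by (rule asymp_onI) (metis less_irrefl less_trans)
    show "transp_on ?T (\<sqsubset>)"
      by (rule transp_onI) (metis less_trans)
    show "?T \<noteq> {}"
      using assms by auto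
  qed
  then obtain m where m: "m \<in> S" "m = a \<or> m \<sqsubset> a" "\<forall>z\<in>?T. z \<noteq> m \<longrightarrow> \<not> z \<sqsubset> m"
    by auto
  have "\<not> z \<sqsubset> m" if "z \<in> S" for z
    using m that less_irrefl less_trans by (metis (mono_tags, lifting) mem_Collect_eq)
  with m show ?thesis
    using that by blast
qed

lemma labeling_inj: "L \<in> labelings P \<Longrightarrow> x \<in> P \<Longrightarrow> y \<in> P \<Longrightarrow> L x = L y \<longleftrightarrow> x = y"
  by (auto simp: labelings_def bij_betw_def inj_on_eq_iff)

lemma labeling_range: "L \<in> labelings P \<Longrightarrow> x \<in> P \<Longrightarrow> 1 \<le> L x \<and> L x \<le> card P"
  by (auto simp: labelings_def bij_betw_def)

lemma labeling_inv:
  assumes "L \<in> labelings P" "1 \<le> k" "k \<le> card P"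
  shows "inv_into P L k \<in> P" "L (inv_into P L k) = k"
proof -
  have "k \<in> L ` P"
    using assms by (auto simp: labelings_def bij_betw_def)
  then show "inv_into P L k \<in> P" "L (inv_into P L k) = k"
    by (auto simp: inv_into_into f_inv_into_f)
qed

lemma label_successor_above:
  assumes "x \<in> P" "x \<notin> maximal_elements P r"
  shows "x \<sqsubset> label_successor P r L x" "x \<sqsubset> y \<Longrightarrow> L (label_successor P r L x) \<le> L y"
proof -
  obtain w where "w \<in> P \<and> x \<sqsubset> w"
    using assms by (auto simp: maximal_elements_def)
  from arg_min_nat_lemma[of "\<lambda>y. y \<in> P \<and> x \<sqsubset> y", OF this, of L]
  show "x \<sqsubset> label_successor P r L x" "x \<sqsubset> y \<Longrightarrow> L (label_successor P r L x) \<le> L y"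
    by (auto simp: label_successor_def less_carrier)
qed

lemma not_maximalI: "x \<sqsubset> y \<Longrightarrow> x \<notin> maximal_elements P r"
  using less_carrier by (auto simp: maximal_elements_def)

lemma label_successor_eqI:
  assumes "L \<in> labelings P" "x \<sqsubset> y" "\<And>z. x \<sqsubset> z \<Longrightarrow> L y \<le> L z"
  shows "label_successor P r L x = y"
proof -
  note s = label_successor_above[OF less_carrier(1)[OF assms(2)] not_maximalI[OF assms(2)], where L = L]
  have "L (label_successor P r L x) = L y"
    using s assms by (meson dual_order.antisym)
  then show ?thesis
    using s(1) assms less_carrier labeling_inj by metis
qed

lemma chain_carrier:
  assumes "L \<in> labelings P" "P \<noteq> {}" "x \<in> promotion_chain P r L"
  shows "x \<in> P"
  using assms(3)
proof induction
  case start
  then show ?case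
    using assms finite_carrier labeling_inv(1)
    by (metis One_nat_def Suc_leI card_gt_0_iff le_refl)
next
  case (step x)
  then show ?case
    using label_successor_above(1) less_carrier by blast
qed

text \<open>Values appear as \<open>promotion P r L x + 1\<close> to keep truncated subtraction out
  of later arithmetic. In the last case the token of \<open>y\<close> drops to \<open>x\<close>, and
  \<open>y\<close>, being in the chain too, is refilled in turn.\<close>

lemma promotion_cases [consumes 2, case_names off_chain maximal on_chain]:
  assumes "L \<in> labelings P" "x \<in> P"
  obtains "x \<notin> promotion_chain P r L" "promotion P r L x + 1 = L x"
  | "x \<in> promotion_chain P r L" "x \<in> maximal_elements P r" "promotion P r L x = card P"
  | y where "x \<in> promotion_chain P r L" "y = label_successor P r L x" "x \<sqsubset> y"
      "y \<in> promotion_chain P r L" "promotion P r L x + 1 = L y" "\<And>z. x \<sqsubset> z \<Longrightarrow> L y \<le> L z"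
proof (cases "x \<in> promotion_chain P r L")
  case False
  then show ?thesis
    using that(1) assms labeling_range[OF assms] by (simp add: promotion_def)
next
  case True
  show ?thesis
  proof (cases "x \<in> maximal_elements P r")
    case True
    then show ?thesis
      using that(2) \<open>x \<in> promotion_chain P r L\<close> assms by (simp add: promotion_def)
  next
    case False
    note s = label_successor_above[OF assms(2) False, where L = L]
    have "1 \<le> L (label_successor P r L x)"
      using labeling_range assms less_carrier s(1) by blast
    then have "promotion P r L x + 1 = L (label_successor P r L x)"
      using True False assms by (simp add: promotion_def)
    then show ?thesis
      using that(3) True s promotion_chain.step[OF True False] by blast
  qed
qed

text \<open>By finiteness, surjectivity onto \<open>{1..card P}\<close> is enough. The value
  \<open>card P\<close> is taken at the end of the chain; a smaller \<open>t\<close> is taken where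
  \<open>L\<close> has \<open>t + 1\<close> or, if that place is in the chain, at its predecessor
  there.\<close>

lemma promotion_labelings:
  assumes L: "L \<in> labelings P"
  shows "promotion P r L \<in> labelings P"
proof (cases "P = {}")
  case True
  then show ?thesis
    by (simp add: labelings_def promotion_def bij_betw_def extensional_def)
next
  case False
  let ?C = "promotion_chain P r L"
  have C: "?C \<subseteq> P"
    using chain_carrier L False by blast
  have "t \<in> promotion P r L ` P" if t: "t \<in> {1..card P}" for t
  proof (cases "t = card P")
    case True
    \<comment> \<open>A maximal element of the chain is maximal in \<open>P\<close>: otherwise its
      label successor would be a chain element above it.\<close>
    obtain m where m: "m \<in> ?C" "\<And>z. z \<in> ?C \<Longrightarrow> \<not> m \<sqsubset> z"
      using ex_maximal_above[OF C promotion_chain.start] by blast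
    then have "m \<in> P"
      using C by auto
    with L have "promotion P r L m = card P"
      by (cases rule: promotion_cases) (use m in auto)
    then show ?thesis
      using True \<open>m \<in> P\<close> by force
  next
    case False
    then have t1: "1 \<le> t + 1" "t + 1 \<le> card P"
      using t by auto
    define y where "y = inv_into P L (t + 1)"
    have y: "y \<in> P" "L y = t + 1"
      using labeling_inv[OF L t1] by (auto simp: y_def)
    show ?thesis
    proof (cases "y \<in> ?C")
      case False
      then have "promotion P r L y = t"
        using y by (simp add: promotion_def)
      then show ?thesis
        using y by force
    next
      case True
      then show ?thesis
      proof cases
        case start
        then have "L y = 1"
          using labeling_inv(2)[OF L, of 1] t by auto
        then show ?thesis
          using y t by simp
      next
        case (step x)
        then have "x \<in> P"
          using C by auto
        then have "promotion P r L x = t"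
          using step y by (simp add: promotion_def)
        then show ?thesis
          using \<open>x \<in> P\<close> by force
      qed
    qed
  qed
  then have sub: "{1..card P} \<subseteq> promotion P r L ` P"
    by auto
  have im: "promotion P r L ` P = {1..card P}"
    using card_seteq[OF _ sub] finite_carrier card_image_le[OF finite_carrier] by auto
  then have "inj_on (promotion P r L) P"
    by (intro eq_card_imp_inj_on) (auto simp: finite_carrier)
  then show ?thesis
    using im by (auto simp: labelings_def bij_betw_def promotion_def)
qed

section \<open>Iterated promotion and the sorting of the large labels\<close>

lemma promotion_iterate_labelings:
  "L \<in> labelings P \<Longrightarrow> (promotion P r ^^ k) L \<in> labelings P"
  by (induction k) (auto simp: promotion_labelings)

text \<open>Only the lower element is required to have a label above \<open>k\<close>; the condition
  therefore also says that the labels above \<open>k\<close> occupy an up-set.\<close>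

definition sorted_above :: "nat \<Rightarrow> ('a \<Rightarrow> nat) \<Rightarrow> bool" where
  "sorted_above k L \<longleftrightarrow> (\<forall>x y. x \<sqsubset> y \<longrightarrow> k < L x \<longrightarrow> L x < L y)"

text \<open>A chain element receives the label of its successor, which is larger by sortedness, so
  no entry above \<open>k\<close> drops by more than \<open>1\<close>.\<close>

lemma sorted_above_promotion_ge:
  assumes "L \<in> labelings P" "sorted_above k L" "x \<in> P" "k < L x"
  shows "L x \<le> promotion P r L x + 1"
  using assms(1,3)
proof (cases rule: promotion_cases)
  case maximal
  then show ?thesis
    using labeling_range[OF assms(1,3)] by simp
next
  case (on_chain y)
  then show ?thesis
    using assms by (simp add: sorted_above_def less_imp_le)
qed simp

text \<open>\<open>x\<close> keeps its token or takes that of its successor \<open>w\<close>, while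
  \<open>y\<close> loses at most \<open>1\<close>. Since \<open>w\<close> has the least label above
  \<open>x\<close>, the order survives if \<open>y \<noteq> w\<close>; if \<open>y = w\<close>, then
  \<open>y\<close> itself is refilled with something larger.\<close>

lemma sorted_above_promotion:
  assumes L: "L \<in> labelings P" and s: "sorted_above k L"
  shows "sorted_above (k - 1) (promotion P r L)"
  unfolding sorted_above_def
proof (intro allI impI)
  fix x y
  assume xy: "x \<sqsubset> y" and k: "k - 1 < promotion P r L x"
  have x: "x \<in> P" and y: "y \<in> P"
    using xy less_carrier by auto
  show "promotion P r L x < promotion P r L y"
    using L x
  proof (cases rule: promotion_cases)
    case off_chain
    then have "k < L x"
      using k by simp
    then have "L x < L y"
      using s xy by (simp add: sorted_above_def)
    then show ?thesis
      using sorted_above_promotion_ge[OF L s y] \<open>k < L x\<close> off_chain by simp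
  next
    case maximal
    then show ?thesis
      using xy not_maximalI by blast
  next
    case (on_chain w)
    then have kw: "k < L w"
      using k by simp
    show ?thesis
    proof (cases "y = w")
      case True
      from L y show ?thesis
      proof (cases rule: promotion_cases)
        case off_chain
        then show ?thesis
          using True on_chain by simp
      next
        case maximal
        then show ?thesis
          using True on_chain labeling_range[OF L y] by simp
      next
        case (on_chain v)
        then have "L y < L v"
          using s kw True by (simp add: sorted_above_def)
        then show ?thesis
          using on_chain \<open>promotion P r L x + 1 = L w\<close> True by simp
      qed
    next
      case False
      then have "L w \<noteq> L y"
        using labeling_inj[OF L] y less_carrier on_chain(3) by metis
      then have "L w < L y"
        using on_chain(6)[OF xy] by simp
      then show ?thesis
        using sorted_above_promotion_ge[OF L s y] kw on_chain(5) by simp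
    qed
  qed
qed

lemma sorted_above_iterate:
  assumes "L \<in> labelings P"
  shows "sorted_above (card P - k) ((promotion P r ^^ k) L)"
proof (induction k)
  case 0
  then show ?case
    using labeling_range[OF assms] less_carrier by (fastforce simp: sorted_above_def)
next
  case (Suc k)
  then show ?case
    using sorted_above_promotion[OF promotion_iterate_labelings[OF assms], of "card P - k" k] by simp
qed

text \<open>Together with \<open>sorted_above k\<close>, this makes a labeling sorted already above
  \<open>k - 1\<close>: the token \<open>k\<close> is in no inversion with an element above
  it.\<close>

definition settled :: "nat \<Rightarrow> ('a \<Rightarrow> nat) \<Rightarrow> bool" where
  "settled k L \<longleftrightarrow> (\<exists>p\<in>P. L p = k \<and> (\<forall>z. p \<sqsubset> z \<longrightarrow> k < L z))"

text \<open>If the token \<open>k\<close> leaves \<open>p\<close>, it drops to some \<open>y\<close>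
  with successor \<open>p\<close>. Then \<open>k\<close> was the least label above \<open>y\<close>,
  and after the promotion all labels above \<open>y\<close> exceed that of the token.\<close>

lemma promotion_decreases_or_settled:
  assumes L: "L \<in> labelings P" and s: "sorted_above k L" and p: "p \<in> P" "L p = k" and "2 \<le> k"
  shows "promotion P r L p = k - 1 \<or> settled (k - 1) (promotion P r L)"
proof -
  have kn: "k \<le> card P"
    using labeling_range[OF L p(1)] p by simp
  define y where "y = inv_into P (promotion P r L) (k - 1)"
  have y: "y \<in> P" "promotion P r L y = k - 1"
    using labeling_inv[OF promotion_labelings[OF L], of "k - 1"] kn \<open>2 \<le> k\<close>
    by (auto simp: y_def)
  from L y(1) show ?thesis
  proof (cases rule: promotion_cases)
    case off_chain
    then have "L y = L p"
      using y(2) p(2) \<open>2 \<le> k\<close> by linarith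
    then have "y = p"
      using labeling_inj[OF L y(1) p(1)] by blast
    then show ?thesis
      using y by simp
  next
    case maximal
    then show ?thesis
      using kn y \<open>2 \<le> k\<close> by simp
  next
    case (on_chain w)
    have "L w = L p"
      using on_chain(5) y(2) p(2) \<open>2 \<le> k\<close> by linarith
    then have "w = p"
      using labeling_inj[OF L less_carrier(2)[OF on_chain(3)] p(1)] by blast
    note yp = on_chain(3-6)[unfolded \<open>w = p\<close>]
    have "k - 1 < promotion P r L z" if yz: "y \<sqsubset> z" for z
    proof (cases "z = p")
      \<comment> \<open>\<open>p\<close> has just been vacated: it is refilled from above, where the
        labels exceed \<open>k\<close>, or with \<open>card P\<close>.\<close>
      case True
      from L p(1) have "k - 1 < promotion P r L p"
      proof (cases rule: promotion_cases)
        case off_chain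
        then show ?thesis
          using yp by simp
      next
        case maximal
        then show ?thesis
          using kn \<open>2 \<le> k\<close> by simp
      next
        case (on_chain v)
        then have "k \<le> L v"
          using yp(4) less_trans[OF yp(1)] p by blast
        moreover have "L v \<noteq> k"
          using labeling_inj[OF L] p on_chain(3) less_carrier less_irrefl by metis
        ultimately show ?thesis
          using on_chain(5) \<open>2 \<le> k\<close> by linarith
      qed
      then show ?thesis
        using True by simp
    next
      case False
      then have "L z \<noteq> k"
        using labeling_inj[OF L] p yz less_carrier by metis
      then have "k < L z"
        using yp(4)[OF yz] p by simp
      then show ?thesis
        using sorted_above_promotion_ge[OF L s less_carrier(2)[OF yz]] \<open>2 \<le> k\<close> by linarith
    qed
    then show ?thesis
      unfolding settled_def using y by blast
  qed
qed

lemma settled_promotion: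
  assumes L: "L \<in> labelings P" and s: "sorted_above k L" and "settled k L" and "2 \<le> k"
  shows "settled (k - 1) (promotion P r L)"
proof -
  obtain p where p: "p \<in> P" "L p = k" "\<And>z. p \<sqsubset> z \<Longrightarrow> k < L z"
    using \<open>settled k L\<close> by (auto simp: settled_def)
  have "settled (k - 1) (promotion P r L)" if "promotion P r L p = k - 1"
  proof -
    have "k - 1 < promotion P r L z" if "p \<sqsubset> z" for z
      using sorted_above_promotion_ge[OF L s less_carrier(2)[OF that] p(3)[OF that]] p(3)[OF that]
        \<open>2 \<le> k\<close> by linarith
    then show ?thesis
      using p that by (auto simp: settled_def)
  qed
  then show ?thesis
    using promotion_decreases_or_settled[OF L s p(1,2) \<open>2 \<le> k\<close>] by blast
qed

text \<open>The token that starts as \<open>card P\<close> has either stayed at \<open>x\<close> or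
  been settled by its first move, and settledness persists.\<close>

lemma top_label_stays_or_settled:
  assumes L: "L \<in> labelings P" and x: "x \<in> P" "L x = card P" and "k + 1 \<le> card P"
  shows "(promotion P r ^^ k) L x = card P - k \<or> settled (card P - k) ((promotion P r ^^ k) L)"
  using \<open>k + 1 \<le> card P\<close>
proof (induction k)
  case 0
  then show ?case
    using x by simp
next
  case (Suc k)
  let ?M = "(promotion P r ^^ k) L"
  have M: "?M \<in> labelings P" "sorted_above (card P - k) ?M"
    using L promotion_iterate_labelings sorted_above_iterate by auto
  have k: "2 \<le> card P - k" "card P - k - 1 = card P - Suc k"
    using Suc by auto
  show ?case
    using Suc promotion_decreases_or_settled[OF M x(1) _ k(1)] settled_promotion[OF M _ k(1)] k(2)
    by auto
qed

text \<open>A minimal element can be in the chain only as its start, that is, with label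
  \<open>1\<close>.\<close>

lemma promotion_minimal:
  assumes L: "L \<in> labelings P" and x: "x \<in> minimal_elements P r" and "2 \<le> L x"
  shows "promotion P r L x = L x - 1"
proof -
  have xP: "x \<in> P"
    using x by (simp add: minimal_elements_def)
  then have "1 \<le> card P" "P \<noteq> {}"
    using labeling_range[OF L xP] by auto
  have "x \<notin> promotion_chain P r L"
  proof
    assume "x \<in> promotion_chain P r L"
    then show False
    proof cases
      case start
      then show False
        using labeling_inv(2)[OF L, of 1] \<open>1 \<le> card P\<close> \<open>2 \<le> L x\<close> by simp
    next
      case (step y)
      then have "y \<sqsubset> x"
        using label_successor_above(1) chain_carrier[OF L \<open>P \<noteq> {}\<close>] by blast
      then show False
        using x less_carrier by (auto simp: minimal_elements_def)
    qed
  qed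
  then show ?thesis
    using xP by (simp add: promotion_def)
qed

lemma promotion_iterate_minimal:
  assumes L: "L \<in> labelings P" and x: "x \<in> minimal_elements P r" "L x = card P" and "k + 1 \<le> card P"
  shows "(promotion P r ^^ k) L x = card P - k"
  using \<open>k + 1 \<le> card P\<close>
proof (induction k)
  case 0
  then show ?case
    using x by simp
next
  case (Suc k)
  then show ?case
    using promotion_minimal[OF promotion_iterate_labelings[OF L] x(1), of k] by simp
qed

text \<open>Where the label \<open>card P - 1\<close> of \<open>L\<close> has ended up after \<open>card P - 2\<close> promotions.\<close>

definition final_place :: "('a \<Rightarrow> nat) \<Rightarrow> 'a" where
  "final_place L = inv_into P ((promotion P r ^^ (card P - 2)) L) 1"

section \<open>Tangled labelings and the final place\<close>

context
  assumes two: "2 \<le> card P"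
begin

lemma final_place:
  assumes "L \<in> labelings P"
  shows "final_place L \<in> P" "(promotion P r ^^ (card P - 2)) L (final_place L) = 1"
  using labeling_inv[OF promotion_iterate_labelings[OF assms], of 1] two
  by (simp_all add: final_place_def)

lemma final_sorted:
  assumes "L \<in> labelings P"
  shows "sorted_above 2 ((promotion P r ^^ (card P - 2)) L)"
  using sorted_above_iterate[OF assms, of "card P - 2"] two by simp

lemma final_label_minimal:
  assumes "L \<in> labelings P" "x \<in> minimal_elements P r" "L x = card P"
  shows "(promotion P r ^^ (card P - 2)) L x = 2"
  using promotion_iterate_minimal[OF assms, of "card P - 2"] two by simp

lemma final_place_neq_minimal:
  assumes "L \<in> labelings P" "x \<in> minimal_elements P r" "L x = card P"
  shows "final_place L \<noteq> x"
  using final_label_minimal[OF assms] final_place(2)[OF assms(1)] by force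

text \<open>Tokens above \<open>2\<close> are sorted, so none of them lies below the token
  \<open>1\<close>. This leaves only the token \<open>2\<close>, which is still at the minimal
  element \<open>x\<close>.\<close>

lemma below_final_place:
  assumes L: "L \<in> labelings P" and x: "x \<in> minimal_elements P r" "L x = card P"
    and d: "d \<sqsubset> final_place L"
  shows "d = x"
proof (rule ccontr)
  let ?M = "(promotion P r ^^ (card P - 2)) L"
  have M: "?M \<in> labelings P"
    using L by (rule promotion_iterate_labelings)
  assume "d \<noteq> x"
  then have "?M d \<noteq> 2"
    using final_label_minimal[OF L x] labeling_inj[OF M] less_carrier[OF d] x
    by (metis (no_types, lifting) mem_Collect_eq minimal_elements_def)
  moreover have "?M d \<noteq> 1"
    using final_place[OF L] labeling_inj[OF M] less_carrier[OF d] d less_irrefl by metis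
  ultimately have "2 < ?M d"
    using labeling_range[OF M less_carrier(1)[OF d]] by linarith
  then have "?M d < ?M (final_place L)"
    using final_sorted[OF L] d by (simp add: sorted_above_def)
  then show False
    using final_place[OF L] \<open>2 < ?M d\<close> by simp
qed

text \<open>By sortedness above \<open>2\<close>, the only inversion that can be left is the token
  \<open>2\<close> below the token \<open>1\<close>.\<close>

lemma tangled_iff_below_final_place:
  assumes L: "L \<in> labelings P" and x: "x \<in> minimal_elements P r" "L x = card P"
  shows "tangled P r L \<longleftrightarrow> x \<sqsubset> final_place L"
proof
  let ?M = "(promotion P r ^^ (card P - 2)) L"
  have M: "?M \<in> labelings P"
    using L by (rule promotion_iterate_labelings)
  have xP: "x \<in> P"
    using x by (simp add: minimal_elements_def)
  {
    assume "tangled P r L"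
    then obtain a b where ab: "a \<in> P" "b \<in> P" "(a, b) \<in> r" "?M b < ?M a"
      using M by (auto simp: tangled_def linear_extension_def not_le)
    then have "a \<sqsubset> b"
      by (auto simp: strict_below_def)
    then have "?M a \<le> 2"
      using final_sorted[OF L] ab(4) by (force simp: sorted_above_def)
    moreover have "1 \<le> ?M b"
      using labeling_range[OF M ab(2)] by simp
    ultimately have "?M a = 2" "?M b = 1"
      using ab(4) by auto
    then have "a = x" "b = final_place L"
      using labeling_inj[OF M] ab xP final_label_minimal[OF L x] final_place[OF L] by metis+
    then show "x \<sqsubset> final_place L"
      using \<open>a \<sqsubset> b\<close> by simp
  next
    assume "x \<sqsubset> final_place L"
    then have "(x, final_place L) \<in> r"
      by (simp add: strict_below_def)
    then show "tangled P r L"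
      using L two xP final_place[OF L] final_label_minimal[OF L x]
      by (force simp: tangled_def linear_extension_def)
  }
qed

text \<open>The token \<open>card P\<close> cannot have moved, since it would then be settled and
  leave a linear extension. So it is still at \<open>x\<close>, now with value \<open>2\<close>, and
  \<open>x\<close> lies below the token \<open>1\<close>.\<close>

lemma tangled_top_minimal:
  assumes t: "tangled P r L"
  obtains x where "x \<in> minimal_elements P r" "L x = card P"
proof -
  let ?M = "(promotion P r ^^ (card P - 2)) L"
  have L: "L \<in> labelings P"
    using t by (simp add: tangled_def)
  have M: "?M \<in> labelings P"
    using L by (rule promotion_iterate_labelings)
  obtain x where x: "x \<in> P" "L x = card P"
    using labeling_inv[OF L, of "card P"] two by auto
  have "\<not> settled 2 ?M"
  proof
    assume "settled 2 ?M"
    then obtain p where p: "p \<in> P" "?M p = 2" "\<And>z. p \<sqsubset> z \<Longrightarrow> 2 < ?M z"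
      by (auto simp: settled_def)
    have "?M a \<le> ?M b" if ab: "a \<in> P" "b \<in> P" "(a, b) \<in> r" for a b
    proof (cases "a = b")
      case False
      then have lt: "a \<sqsubset> b"
        using ab by (simp add: strict_below_def)
      have "?M a = 1 \<or> ?M a = 2 \<or> 2 < ?M a"
        using labeling_range[OF M ab(1)] by linarith
      then show ?thesis
        using final_sorted[OF L] lt labeling_range[OF M ab(2)] p labeling_inj[OF M ab(1) p(1)]
        by (force simp: sorted_above_def)
    qed simp
    then have "linear_extension P r ?M"
      using M by (simp add: linear_extension_def)
    then show False
      using t by (simp add: tangled_def)
  qed
  then have Mx: "?M x = 2"
    using top_label_stays_or_settled[OF L x, of "card P - 2"] two by auto
  obtain a b where ab: "a \<in> P" "b \<in> P" "(a, b) \<in> r" "?M b < ?M a"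
    using M t by (auto simp: tangled_def linear_extension_def not_le)
  then have lt: "a \<sqsubset> b"
    by (auto simp: strict_below_def)
  have "?M a \<le> 2"
    using final_sorted[OF L] lt ab(4) by (force simp: sorted_above_def)
  then have "?M a = 2" "?M b = 1"
    using labeling_range[OF M ab(2)] ab(4) by auto
  then have "a = x"
    using labeling_inj[OF M] ab x Mx by metis
  \<comment> \<open>An element below \<open>x\<close> would carry a token above \<open>2\<close> and
    violate sortedness against \<open>x\<close>.\<close>
  have "\<not> w \<sqsubset> x" for w
  proof
    assume w: "w \<sqsubset> x"
    then have "w \<noteq> x" "w \<noteq> b"
      using lt \<open>a = x\<close> less_irrefl less_trans by blast+
    then have "?M w \<noteq> 2" "?M w \<noteq> 1"
      using Mx \<open>?M b = 1\<close> labeling_inj[OF M] less_carrier[OF w] ab(2) by metis+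
    then have "2 < ?M w"
      using labeling_range[OF M less_carrier(1)[OF w]] by linarith
    then have "?M w < ?M x"
      using final_sorted[OF L] w by (simp add: sorted_above_def)
    then show False
      using \<open>2 < ?M w\<close> Mx by simp
  qed
  then show ?thesis
    using that[of x] x by (simp add: minimal_elements_def)
qed

end

end

section \<open>Down-sets seen uniformly from outside\<close>

text \<open>An element outside \<open>D\<close> is above all of \<open>D\<close> or above none of
  it, and never below any of it; \<open>C\<close> is a union of connected components of
  \<open>D\<close>. \<open>D_bounded\<close> ensures that a promotion chain starting in
  \<open>D\<close> leaves it.\<close>

locale promotion_module = promotion_poset +
  fixes D C :: "'a set"
  assumes D_carrier: "D \<subseteq> P"
    and D_down: "a \<sqsubset> b \<Longrightarrow> b \<in> D \<Longrightarrow> a \<in> D"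
    and D_uniform: "d \<in> D \<Longrightarrow> d \<sqsubset> y \<Longrightarrow> y \<notin> D \<Longrightarrow> d' \<in> D \<Longrightarrow> d' \<sqsubset> y"
    and D_bounded: "\<exists>y\<in>P - D. \<forall>d\<in>D. d \<sqsubset> y"
    and C_subset: "C \<subseteq> D"
    and C_component: "a \<sqsubset> b \<Longrightarrow> b \<in> D \<Longrightarrow> a \<in> C \<longleftrightarrow> b \<in> C"
begin

definition roof :: "'a set" where
  "roof = {y \<in> P - D. \<forall>d\<in>D. d \<sqsubset> y}"

text \<open>
  If the label \<open>1\<close> lies in \<open>D\<close>, the promotion chain leaves \<open>D\<close> at the least label of the roof,
  and this label drops into the component in which \<open>1\<close> was. So \<open>pull L\<close> sends a label that
  \<open>D\<close> carries after the promotion to one that was in the same component before.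
\<close>

definition pull :: "('a \<Rightarrow> nat) \<Rightarrow> nat \<Rightarrow> nat" where
  "pull L t = (if t + 1 = Min (L ` roof) then 1 else t + 1)"

text \<open>Traces a label found in \<open>D\<close> back through \<open>k\<close> promotions to a
  label of \<open>L\<close>, undoing the latest promotion first.\<close>

primrec pulls :: "('a \<Rightarrow> nat) \<Rightarrow> nat \<Rightarrow> nat \<Rightarrow> nat" where
  "pulls L 0 t = t"
| "pulls L (Suc k) t = pulls L k (pull ((promotion P r ^^ k) L) t)"

definition agree :: "('a \<Rightarrow> nat) \<Rightarrow> ('a \<Rightarrow> nat) \<Rightarrow> bool" where
  "agree L L' \<longleftrightarrow> (\<forall>y\<in>P - D. L y = L' y)"

lemma agree_sym: "agree L L' \<Longrightarrow> agree L' L"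
  by (simp add: agree_def)

lemma carrier_nonempty: "P \<noteq> {}"
  using D_bounded by auto

lemma card_carrier: "1 \<le> card P"
  using carrier_nonempty finite_carrier by (simp add: Suc_le_eq card_gt_0_iff)

lemma roof_finite: "finite roof" and roof_nonempty: "roof \<noteq> {}"
  using finite_carrier D_bounded by (auto simp: roof_def)

lemma D_not_maximal: "d \<in> D \<Longrightarrow> d \<notin> maximal_elements P r"
  using D_bounded not_maximalI by blast

text \<open>By uniformity an element above \<open>d\<close> and outside \<open>D\<close> is in the
  roof, and the whole roof lies above \<open>d\<close>; minimality among the elements above
  \<open>d\<close> thus gives minimality in the roof.\<close>

lemma exit_label:
  assumes "d \<in> D" "label_successor P r L d \<notin> D"
  shows "L (label_successor P r L d) = Min (L ` roof)"
proof -
  let ?s = "label_successor P r L d"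
  have dP: "d \<in> P"
    using assms D_carrier by auto
  note s = label_successor_above[OF dP D_not_maximal[OF assms(1)], where L = L]
  have "?s \<in> roof"
    using D_uniform[OF assms(1) s(1) assms(2)] less_carrier(2)[OF s(1)] assms(2)
    by (simp add: roof_def)
  moreover have "L ?s \<le> L b" if "b \<in> roof" for b
    using that s(2) assms(1) by (simp add: roof_def)
  ultimately show ?thesis
    using roof_finite by (intro Min_eqI[symmetric]) auto
qed

text \<open>The chain goes upward and \<open>D\<close> is a down-set, so all predecessors of a chain
  element in \<open>D\<close> are in \<open>D\<close>, linked to it by comparabilities.\<close>

lemma chain_in_D:
  assumes L: "L \<in> labelings P" and "z \<in> promotion_chain P r L" "z \<in> D"
  shows "inv_into P L 1 \<in> D \<and> (inv_into P L 1 \<in> C \<longleftrightarrow> z \<in> C)"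
  using assms(2,3)
proof induction
  case start
  then show ?case
    by simp
next
  case (step a)
  have "a \<sqsubset> label_successor P r L a"
    using step chain_carrier[OF L carrier_nonempty] label_successor_above(1) by blast
  then show ?case
    using step D_down C_component by blast
qed

lemma chain_leaves_D:
  assumes L: "L \<in> labelings P" and "inv_into P L 1 \<in> D"
  obtains d where "d \<in> D" "label_successor P r L d \<in> promotion_chain P r L"
    "label_successor P r L d \<notin> D"
proof -
  let ?S = "promotion_chain P r L \<inter> D"
  have S: "?S \<subseteq> P" "inv_into P L 1 \<in> ?S"
    using D_carrier assms promotion_chain.start by auto
  \<comment> \<open>The last chain element in \<open>D\<close> is not maximal in \<open>P\<close>,
    so its successor is in the chain and outside \<open>D\<close>.\<close>
  obtain d where d: "d \<in> ?S" "\<And>z. z \<in> ?S \<Longrightarrow> \<not> d \<sqsubset> z"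
    using ex_maximal_above[OF S] by blast
  have "d \<sqsubset> label_successor P r L d"
    using d S label_successor_above(1) D_not_maximal by blast
  moreover have "label_successor P r L d \<in> promotion_chain P r L"
    using d D_not_maximal promotion_chain.step by fast
  ultimately show ?thesis
    using that d by blast
qed

section \<open>Labelings that agree outside \<open>D\<close>\<close>

context
  fixes L L' :: "'a \<Rightarrow> nat"
  assumes L: "L \<in> labelings P" and L': "L' \<in> labelings P" and LL': "agree L L'"
begin

lemma agree_image_roof: "L ` roof = L' ` roof"
  using LL' by (auto simp: agree_def roof_def)

lemma agree_inv:
  assumes "1 \<le> k" "k \<le> card P" "inv_into P L k \<in> D"
  shows "inv_into P L' k \<in> D"
proof (rule ccontr)
  assume "inv_into P L' k \<notin> D"
  then have "L (inv_into P L' k) = k"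
    using labeling_inv[OF L' assms(1,2)] LL' by (simp add: agree_def)
  then have "inv_into P L' k = inv_into P L k"
    using labeling_inv[OF L assms(1,2)] labeling_inv[OF L' assms(1,2)] labeling_inj[OF L] by metis
  then show False
    using assms \<open>inv_into P L' k \<notin> D\<close> by simp
qed

lemma agree_label_successor:
  assumes "z \<in> P - D" "z \<notin> maximal_elements P r"
  shows "label_successor P r L' z = label_successor P r L z"
proof (rule label_successor_eqI[OF L'])
  have zP: "z \<in> P"
    using assms by simp
  note s = label_successor_above[OF zP assms(2), where L = L]
  show "z \<sqsubset> label_successor P r L z"
    by (rule s(1))
  have out: "L' y = L y" if "z \<sqsubset> y" for y
    using that assms D_down less_carrier LL' unfolding agree_def by fastforce
  show "L' (label_successor P r L z) \<le> L' y" if "z \<sqsubset> y" for y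
    using s(2)[OF that] out[OF that] out[OF s(1)] by simp
qed

text \<open>From outside \<open>D\<close> both chains take the same steps. If one comes out of
  \<open>D\<close>, the other starts in \<open>D\<close> too, and both come out at the least label
  of the roof. One inclusion suffices, by symmetry.\<close>

lemma agree_chain:
  assumes "z \<in> promotion_chain P r L" "z \<notin> D"
  shows "z \<in> promotion_chain P r L'"
  using assms
proof induction
  case start
  note i = labeling_inv[OF L order_refl card_carrier]
  have "L' (inv_into P L 1) = 1"
    using i start LL' by (simp add: agree_def)
  then have "inv_into P L' 1 = inv_into P L 1"
    using i labeling_inv[OF L' order_refl card_carrier] labeling_inj[OF L'] by metis
  then show ?case
    by (metis promotion_chain.start)
next
  case (step a)
  have aP: "a \<in> P"
    using step chain_carrier[OF L carrier_nonempty] by blast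
  show ?case
  proof (cases "a \<in> D")
    case False
    then show ?thesis
      using step aP agree_label_successor[of a] promotion_chain.step[of a P r L'] by simp
  next
    case True
    then have "inv_into P L 1 \<in> D"
      using chain_in_D[OF L] step by blast
    then have "inv_into P L' 1 \<in> D"
      using agree_inv card_carrier by blast
    from chain_leaves_D[OF L' this] obtain d where
      d: "d \<in> D" "label_successor P r L' d \<in> promotion_chain P r L'"
        "label_successor P r L' d \<notin> D"
      by blast
    define e where "e = label_successor P r L' d"
    have e: "e \<in> P" "e \<notin> D"
      using chain_carrier[OF L' carrier_nonempty] d by (auto simp: e_def)
    have "L' e = L (label_successor P r L a)"
      using exit_label[OF d(1,3)] exit_label[OF True step.prems] agree_image_roof
      by (simp add: e_def)
    moreover have "L e = L' e"
      using e LL' by (simp add: agree_def)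
    moreover have "label_successor P r L a \<in> P"
      using label_successor_above(1)[OF aP step.hyps(2)] less_carrier by blast
    ultimately have "e = label_successor P r L a"
      using labeling_inj[OF L] e by metis
    then show ?thesis
      using d by (simp add: e_def)
  qed
qed

lemma agree_pull: "pull L = pull L'"
  by (simp add: pull_def agree_image_roof fun_eq_iff)

end

lemma agree_promotion:
  assumes L: "L \<in> labelings P" and L': "L' \<in> labelings P" and LL': "agree L L'"
  shows "agree (promotion P r L) (promotion P r L')"
  unfolding agree_def
proof
  fix y assume y: "y \<in> P - D"
  have chain: "y \<in> promotion_chain P r L \<longleftrightarrow> y \<in> promotion_chain P r L'"
    using agree_chain[OF L L' LL'] agree_chain[OF L' L agree_sym[OF LL']] y by blast
  have "L (label_successor P r L y) = L' (label_successor P r L' y)"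
    if m: "y \<notin> maximal_elements P r"
  proof -
    have yP: "y \<in> P"
      using y by simp
    note s = label_successor_above(1)[OF yP m, where L = L]
    have "label_successor P r L y \<in> P - D"
      using s y D_down less_carrier by blast
    then show ?thesis
      using agree_label_successor[OF L L' LL' y m] LL' by (simp add: agree_def)
  qed
  then show "promotion P r L y = promotion P r L' y"
    using y chain LL' by (simp add: promotion_def agree_def)
qed

lemma agree_iterate:
  assumes L: "L \<in> labelings P" and L': "L' \<in> labelings P" and LL': "agree L L'"
  shows "agree ((promotion P r ^^ k) L) ((promotion P r ^^ k) L')"
  by (induction k) (auto simp: LL' agree_promotion promotion_iterate_labelings L L')

lemma agree_pulls:
  assumes L: "L \<in> labelings P" and L': "L' \<in> labelings P" and LL': "agree L L'"
  shows "pulls L k t = pulls L' k t"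
proof (induction k arbitrary: t)
  case (Suc k)
  have "pull ((promotion P r ^^ k) L) = pull ((promotion P r ^^ k) L')"
    using agree_pull agree_iterate[OF L L' LL'] promotion_iterate_labelings L L' by blast
  then show ?case
    using Suc by simp
qed simp

text \<open>For \<open>k = card P - 2\<close> and \<open>t = 1\<close> the traced label is at most
  \<open>card P - 1\<close>, hence never the top label.\<close>

lemma pulls_le: "pulls L k t \<le> t + k"
proof (induction k arbitrary: t)
  case (Suc k)
  have "pulls L (Suc k) t \<le> pull ((promotion P r ^^ k) L) t + k"
    using Suc by simp
  also have "\<dots> \<le> t + Suc k"
    by (simp add: pull_def)
  finally show ?case .
qed simp

text \<open>The token at \<open>z\<close> stayed there, dropped within \<open>D\<close>, or came in
  from the roof. The first two keep the component; in the third the chain runs through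
  \<open>z\<close>, so the label \<open>1\<close> was in the component of \<open>z\<close>.\<close>

lemma pull_same_component:
  assumes L: "L \<in> labelings P" and z: "z \<in> D"
  shows "\<exists>w\<in>D. (w \<in> C \<longleftrightarrow> z \<in> C) \<and> L w = pull L (promotion P r L z)"
proof -
  \<comment> \<open>The roof is disjoint from \<open>D\<close>, so \<open>pull\<close> takes its
    exceptional value only for a token that came from outside.\<close>
  have neq: "L w \<noteq> Min (L ` roof)" if "w \<in> D" for w
  proof
    assume "L w = Min (L ` roof)"
    then have "L w \<in> L ` roof"
      using roof_finite roof_nonempty by simp
    then obtain b where "b \<in> roof" "L w = L b"
      by auto
    then have "w = b"
      using labeling_inj[OF L] that D_carrier by (auto simp: roof_def)
    then show False
      using that \<open>b \<in> roof\<close> by (simp add: roof_def)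
  qed
  have zP: "z \<in> P"
    using z D_carrier by auto
  from L zP show ?thesis
  proof (cases rule: promotion_cases)
    case off_chain
    then have "L z = pull L (promotion P r L z)"
      using neq[OF z] by (simp add: pull_def)
    then show ?thesis
      using z by blast
  next
    case maximal
    then show ?thesis
      using D_not_maximal z by blast
  next
    case (on_chain y)
    show ?thesis
    proof (cases "y \<in> D")
      case True
      then have "L y = pull L (promotion P r L z)"
        using on_chain(5) neq[OF True] by (simp add: pull_def)
      then show ?thesis
        using True C_component[OF on_chain(3) True] by blast
    next
      case False
      then have "L y = Min (L ` roof)"
        using exit_label[OF z] on_chain(2) by simp
      then have "pull L (promotion P r L z) = 1"
        using on_chain(5) by (simp add: pull_def)
      then show ?thesis
        using chain_in_D[OF L on_chain(1) z] labeling_inv(2)[OF L order_refl card_carrier]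
        by metis
    qed
  qed
qed

lemma pulls_same_component:
  assumes L: "L \<in> labelings P" and z: "z \<in> D"
  shows "\<exists>w\<in>D. (w \<in> C \<longleftrightarrow> z \<in> C) \<and> L w = pulls L k ((promotion P r ^^ k) L z)"
  using z
proof (induction k arbitrary: z)
  case 0
  then show ?case
    by auto
next
  case (Suc k)
  \<comment> \<open>\<open>v\<close> undoes the last promotion only; the earlier ones are undone
    from \<open>v\<close>, hence the generalization over \<open>z\<close>.\<close>
  obtain v where v: "v \<in> D" "v \<in> C \<longleftrightarrow> z \<in> C"
    "(promotion P r ^^ k) L v = pull ((promotion P r ^^ k) L) ((promotion P r ^^ Suc k) L z)"
    using pull_same_component[OF promotion_iterate_labelings[OF L, of k] Suc.prems] by auto
  then show ?case
    using Suc.IH[OF v(1)] by simp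
qed

definition origin :: "('a \<Rightarrow> nat) \<Rightarrow> nat" where
  "origin L = pulls L (card P - 2) 1"

text \<open>
  Exchanging the labels of two elements of \<open>D - {x}\<close> changes neither \<open>origin\<close> nor whether the
  final place is in \<open>D\<close>, so the element of \<open>D - {x}\<close> labelled \<open>origin\<close> is uniformly distributed.
\<close>

lemma card_final_place:
  assumes two: "2 \<le> card P" and x: "x \<in> minimal_elements P r" "x \<in> C"
  shows "card {L \<in> labelings P. L x = card P \<and> final_place L \<in> C} * (card D - 1) =
    card {L \<in> labelings P. L x = card P \<and> final_place L \<in> D} * (card C - 1)"
proof -
  define F where "F S = {L \<in> labelings P. L x = card P \<and> final_place L \<in> S}" for S
  \<comment> \<open>The classes \<open>N y\<close> sort the labelings by the place of the
    traced-back label; they will turn out to be equally large.\<close>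
  define N where "N y = {L \<in> F D. L y = origin L}" for y
  have finF: "finite (F S)" for S
    using finite_labelings[OF finite_carrier] by (simp add: F_def)
  have finN: "finite (N y)" for y
    using finF by (simp add: N_def)
  have xD: "x \<in> D"
    using x C_subset by auto
  have finD: "finite D"
    using D_carrier finite_carrier finite_subset by blast
  have swap: "card (N y) \<le> card (N y')" if y: "y \<in> D - {x}" "y' \<in> D - {x}" for y y'
  proof (rule card_inj_on_le[OF _ _ finN])
    show "inj_on (\<lambda>L. L \<circ> transpose y y') (N y)"
      by (rule inj_onI) (metis comp_assoc comp_id transpose_comp_involutory)
    show "(\<lambda>L. L \<circ> transpose y y') ` N y \<subseteq> N y'"
    proof
      fix M assume "M \<in> (\<lambda>L. L \<circ> transpose y y') ` N y"
      then obtain L where LN: "L \<in> N y" and M: "M = L \<circ> transpose y y'"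
        by auto
      have L: "L \<in> labelings P" "L x = card P" "final_place L \<in> D" "L y = origin L"
        using LN by (auto simp: N_def F_def)
      have Mlab: "M \<in> labelings P"
        using labeling_transpose[OF L(1)] y D_carrier M by blast
      have ag: "agree L M"
        using y by (auto simp: agree_def M transpose_def)
      have "M x = card P"
        using L(2) y by (auto simp: M transpose_def)
      moreover have "final_place M \<in> D"
        using agree_inv[OF promotion_iterate_labelings[OF L(1)] promotion_iterate_labelings[OF Mlab]
            agree_iterate[OF L(1) Mlab ag]] L(3) card_carrier
        by (simp add: final_place_def)
      moreover have "origin M = origin L"
        using agree_pulls[OF L(1) Mlab ag] by (simp add: origin_def)
      ultimately show "M \<in> N y'"
        using Mlab L(4) by (simp add: N_def F_def M)
    qed
  qed
  \<comment> \<open>\<open>swap\<close> in both directions makes the sizes equal; if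
    \<open>D - {x}\<close> is empty, any \<open>c\<close> will do.\<close>
  obtain c where c: "\<And>y. y \<in> D - {x} \<Longrightarrow> card (N y) = c"
    using swap by (metis order_antisym)
  have track: "\<exists>w\<in>D - {x}. (w \<in> C \<longleftrightarrow> final_place L \<in> C) \<and> L w = origin L" if "L \<in> F D" for L
  proof -
    have L: "L \<in> labelings P" "L x = card P" "final_place L \<in> D"
      using that by (auto simp: F_def)
    obtain w where w: "w \<in> D" "w \<in> C \<longleftrightarrow> final_place L \<in> C" "L w = origin L"
      using pulls_same_component[OF L(1,3), of "card P - 2"] final_place(2)[OF two L(1)]
      by (auto simp: origin_def)
    have "origin L < card P"
      using pulls_le[of L "card P - 2" 1] two by (simp add: origin_def)
    then have "w \<noteq> x"
      using w L by auto
    then show ?thesis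
      using w by blast
  qed
  have count: "card (F S) = card (S - {x}) * c"
    if S: "S \<subseteq> D" and FS: "F S = (\<Union>y\<in>S - {x}. N y)" for S
  proof -
    have "finite (S - {x})"
      using S finD finite_subset by blast
    moreover have "N y \<inter> N y' = {}" if y: "y \<in> S - {x}" "y' \<in> S - {x}" "y \<noteq> y'" for y y'
    proof -
      have "L y \<noteq> L y'" if "L \<in> labelings P" for L
        using labeling_inj[OF that, of y y'] y S D_carrier by blast
      then show ?thesis
        by (auto simp: N_def F_def) metis
    qed
    ultimately have "card (F S) = (\<Sum>y\<in>S - {x}. card (N y))"
      unfolding FS using finN by (intro card_UN_disjoint) auto
    also have "\<dots> = (\<Sum>y\<in>S - {x}. c)"
      using S c by (intro sum.cong) auto
    finally show ?thesis
      by simp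
  qed
  have "F D = (\<Union>y\<in>D - {x}. N y)"
    using track by (auto simp: N_def)
  then have "card (F D) = card (D - {x}) * c"
    by (rule count[OF order_refl])
  moreover have "F C = (\<Union>y\<in>C - {x}. N y)"
  proof (intro equalityI subsetI)
    fix L assume "L \<in> F C"
    then have "L \<in> F D" "final_place L \<in> C"
      using C_subset by (auto simp: F_def)
    then show "L \<in> (\<Union>y\<in>C - {x}. N y)"
      using track[of L] by (auto simp: N_def)
  next
    fix L assume "L \<in> (\<Union>y\<in>C - {x}. N y)"
    then obtain y where y: "y \<in> C" "L \<in> F D" "L y = origin L"
      by (auto simp: N_def)
    have L: "L \<in> labelings P"
      using y by (simp add: F_def)
    obtain w where w: "w \<in> D" "w \<in> C \<longleftrightarrow> final_place L \<in> C" "L w = origin L"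
      using track[OF y(2)] by auto
    \<comment> \<open>The traced element is the one labelled \<open>origin L\<close>, so it is
      \<open>y\<close>, and its membership in \<open>C\<close> passes to the final place.\<close>
    then have "w = y"
      using y labeling_inj[OF L] C_subset D_carrier by (metis subsetD)
    then show "L \<in> F C"
      using y w by (simp add: F_def)
  qed
  then have "card (F C) = card (C - {x}) * c"
    by (rule count[OF C_subset])
  ultimately show ?thesis
    using x xD by (simp add: F_def)
qed

end

section \<open>Inflations of rooted trees\<close>

lemma (in promotion_poset) ex_cover_below:
  assumes "a \<sqsubset> b"
  obtains m where "covers P r m a" "m = b \<or> m \<sqsubset> b"
proof -
  let ?S = "{z \<in> P. a \<sqsubset> z}"
  have "?S \<subseteq> P" "b \<in> ?S"
    using assms less_carrier by auto
  then obtain m where m: "m \<in> ?S" "m = b \<or> m \<sqsubset> b" "\<And>z. z \<in> ?S \<Longrightarrow> \<not> z \<sqsubset> m"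
    using ex_minimal_below by blast
  then have "covers P r m a"
    using less_carrier by (auto simp: covers_def)
  then show ?thesis
    using that m by blast
qed

text \<open>\<open>b\<close> and \<open>c\<close> both lie weakly above the unique cover of
  \<open>a\<close>, which has fewer elements above it than \<open>a\<close>.\<close>

lemma (in promotion_poset) comparable_above:
  assumes cov: "\<forall>x\<in>P. card {y \<in> P. covers P r y x} \<le> 1"
    and "a \<sqsubset> b" "a \<sqsubset> c"
  shows "b = c \<or> b \<sqsubset> c \<or> c \<sqsubset> b"
  using assms(2,3)
proof (induction "card {z. a \<sqsubset> z}" arbitrary: a rule: less_induct)
  case less
  obtain m where m: "covers P r m a" "m = b \<or> m \<sqsubset> b"
    using ex_cover_below[OF less.prems(1)] by blast
  obtain m' where m': "covers P r m' a" "m' = c \<or> m' \<sqsubset> c"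
    using ex_cover_below[OF less.prems(2)] by blast
  have "card {y \<in> P. covers P r y a} \<le> Suc 0" "finite {y \<in> P. covers P r y a}"
    using cov less_carrier(1)[OF less.prems(1)] finite_carrier by auto
  then have eq: "m = m'"
    using m m' card_le_Suc0_iff_eq unfolding covers_def by blast
  show ?case
  proof (cases "m = b \<or> m = c")
    case True
    then show ?thesis
      using m m' eq by blast
  next
    case False
    then have mbc: "m \<sqsubset> b" "m \<sqsubset> c"
      using m m' eq by auto
    have am: "a \<sqsubset> m"
      using m by (simp add: covers_def)
    have "finite {z. a \<sqsubset> z}"
      using finite_carrier less_carrier finite_subset[of "{z. a \<sqsubset> z}" P] by blast
    moreover have "{z. m \<sqsubset> z} \<subset> {z. a \<sqsubset> z}"
      using am less_trans less_irrefl by blast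
    ultimately have "card {z. m \<sqsubset> z} < card {z. a \<sqsubset> z}"
      by (rule psubset_card_mono)
    then show ?thesis
      using less.hyps mbc by blast
  qed
qed

section \<open>Down-sets of the inflation given by tree elements\<close>

locale inflated_tree =
  fixes P :: "'p set" and rP :: "'p rel" and Q :: "'q set" and rQ :: "'q rel" and \<phi> :: "'p \<Rightarrow> 'q"
  assumes tree: "rooted_tree_poset Q rQ" and reduced: "reduced_poset Q rQ"
    and inflation: "inflation P rP Q rQ \<phi>"
    and two: "2 \<le> card P"
begin

sublocale P: promotion_poset P rP
  using inflation by unfold_locales (simp add: inflation_def)

sublocale Q: promotion_poset Q rQ
  using inflation by unfold_locales (simp add: inflation_def)

text \<open>When \<open>v\<close> covers \<open>w\<close>, the sets \<open>below v\<close> and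
  \<open>weakly_below w\<close> serve as \<open>D\<close> and \<open>C\<close>; along a path to the
  root their sizes are the numbers \<open>c_num\<close> and \<open>b_num\<close>.\<close>

definition below :: "'q \<Rightarrow> 'p set" where
  "below v = {p \<in> P. strict_below rQ (\<phi> p) v}"

definition weakly_below :: "'q \<Rightarrow> 'p set" where
  "weakly_below v = {p \<in> P. (\<phi> p, v) \<in> rQ}"

lemma map_carrier: "p \<in> P \<Longrightarrow> \<phi> p \<in> Q"
  using inflation by (auto simp: inflation_def)

lemma fiber_nonempty: "v \<in> Q \<Longrightarrow> \<exists>p\<in>P. \<phi> p = v"
  using inflation by (auto simp: inflation_def)

lemma map_less: "strict_below rP p q \<Longrightarrow> \<phi> p = \<phi> q \<or> strict_below rQ (\<phi> p) (\<phi> q)"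
  using inflation P.less_carrier unfolding inflation_def by blast

lemma less_of_map_less:
  "p \<in> P \<Longrightarrow> q \<in> P \<Longrightarrow> strict_below rQ (\<phi> p) (\<phi> q) \<Longrightarrow> strict_below rP p q"
  using inflation Q.less_irrefl unfolding inflation_def by metis

lemma weakly_below_iff: "p \<in> weakly_below v \<longleftrightarrow> p \<in> P \<and> (\<phi> p = v \<or> strict_below rQ (\<phi> p) v)"
  using Q.le_iff map_carrier by (auto simp: weakly_below_def)

lemma comparable:
  "strict_below rQ a b \<Longrightarrow> strict_below rQ a c \<Longrightarrow>
    b = c \<or> strict_below rQ b c \<or> strict_below rQ c b"
  using Q.comparable_above tree by (simp add: rooted_tree_poset_def)

lemma card_vimage:
  assumes "W \<subseteq> Q"
  shows "card {p \<in> P. \<phi> p \<in> W} = (\<Sum>v\<in>W. card (fiber P \<phi> v))"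
proof -
  have "{p \<in> P. \<phi> p \<in> W} = (\<Union>v\<in>W. fiber P \<phi> v)"
    by (auto simp: fiber_def)
  moreover have "finite W"
    using assms Q.finite_carrier finite_subset by blast
  ultimately show ?thesis
    using P.finite_carrier by (simp add: card_UN_disjoint fiber_def disjoint_iff)
qed

lemma card_below: "card (below v) = (\<Sum>w\<in>{w \<in> Q. strict_below rQ w v}. card (fiber P \<phi> w))"
  using card_vimage[of "{w \<in> Q. strict_below rQ w v}"] map_carrier
  by (simp add: below_def cong: conj_cong)

lemma card_weakly_below: "card (weakly_below v) = (\<Sum>w\<in>{w \<in> Q. (w, v) \<in> rQ}. card (fiber P \<phi> w))"
  using card_vimage[of "{w \<in> Q. (w, v) \<in> rQ}"] map_carrier
  by (simp add: weakly_below_def cong: conj_cong)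

lemma module:
  assumes cov: "covers Q rQ v w"
  shows "promotion_module P rP (below v) (weakly_below w)"
proof
  have wv: "strict_below rQ w v" and vQ: "v \<in> Q"
    using cov by (auto simp: covers_def)
  show "below v \<subseteq> P"
    by (auto simp: below_def)
  show "a \<in> below v" if "strict_below rP a b" "b \<in> below v" for a b
    using that map_less[OF that(1)] Q.less_trans P.less_carrier by (auto simp: below_def)
  show "strict_below rP d' y"
    if "d \<in> below v" "strict_below rP d y" "y \<notin> below v" "d' \<in> below v" for d y d'
  proof -
    have y: "y \<in> P" "\<not> strict_below rQ (\<phi> y) v"
      using that P.less_carrier by (auto simp: below_def)
    have d: "strict_below rQ (\<phi> d) v"
      using that by (simp add: below_def)
    then have "strict_below rQ (\<phi> d) (\<phi> y)"
      using map_less[OF that(2)] y by auto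
    \<comment> \<open>\<open>v\<close> and \<open>\<phi> y\<close> both lie above
      \<open>\<phi> d\<close>, and elements above a common tree element are comparable.\<close>
    then have "v = \<phi> y \<or> strict_below rQ v (\<phi> y)"
      using comparable[OF d] y by blast
    then show ?thesis
      using that y less_of_map_less Q.less_trans by (auto simp: below_def)
  qed
  show "\<exists>y\<in>P - below v. \<forall>d\<in>below v. strict_below rP d y"
  proof -
    obtain y where "y \<in> P" "\<phi> y = v"
      using fiber_nonempty vQ by blast
    then show ?thesis
      using less_of_map_less Q.less_irrefl by (auto simp: below_def intro!: bexI[of _ y])
  qed
  show "weakly_below w \<subseteq> below v"
    using wv Q.less_trans by (auto simp: weakly_below_iff below_def)
  show "a \<in> weakly_below w \<longleftrightarrow> b \<in> weakly_below w" if ab: "strict_below rP a b" and b: "b \<in> below v" for a b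
  proof
    assume "b \<in> weakly_below w"
    then show "a \<in> weakly_below w"
      using map_less[OF ab] P.less_carrier[OF ab] Q.less_trans unfolding weakly_below_iff by metis
  next
    assume a: "a \<in> weakly_below w"
    have bP: "b \<in> P" "\<phi> b \<in> Q" "strict_below rQ (\<phi> b) v"
      using b map_carrier by (auto simp: below_def)
    \<comment> \<open>As \<open>v\<close> covers \<open>w\<close>, nothing lies strictly between
      them.\<close>
    have "\<not> strict_below rQ w (\<phi> b)"
      using cov bP by (auto simp: covers_def)
    then have "\<phi> b = w \<or> strict_below rQ (\<phi> b) w"
      using a map_less[OF ab] comparable[of "\<phi> a" w "\<phi> b"] unfolding weakly_below_iff by metis
    then show "b \<in> weakly_below w"
      using bP by (simp add: weakly_below_iff)
  qed
qed

text \<open>Reducedness enters here: \<open>v\<close> covers some \<open>z\<close> besides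
  \<open>w\<close>, and the fibers of \<open>w\<close> and \<open>z\<close> both lie in
  \<open>below v\<close>, so at least one of them avoids \<open>x\<close>.\<close>

lemma below_other:
  assumes cov: "covers Q rQ v w" and x: "x \<in> P"
  shows "\<exists>d\<in>below v. d \<noteq> x"
proof -
  have "w \<in> {y \<in> Q. covers Q rQ v y}" "card {y \<in> Q. covers Q rQ v y} \<noteq> 1"
    using cov reduced by (auto simp: covers_def reduced_poset_def)
  then obtain z where z: "z \<in> Q" "covers Q rQ v z" "z \<noteq> w"
    by (metis (no_types, lifting) is_singletonI' is_singleton_altdef empty_iff mem_Collect_eq)
  have "\<exists>d\<in>below v. \<phi> d = y" if "covers Q rQ v y" for y
    using that fiber_nonempty[of y] by (auto simp: covers_def below_def)
  then show ?thesis
    using z cov by metis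
qed

text \<open>Keeps the denominators \<open>card (below v) - 1\<close> positive.\<close>

lemma card_below_ge: "covers Q rQ v w \<Longrightarrow> 2 \<le> card (below v)"
proof -
  assume cov: "covers Q rQ v w"
  have "finite (below v)"
    using P.finite_carrier by (simp add: below_def)
  obtain x where "x \<in> P"
    using two by fastforce
  then obtain a where a: "a \<in> below v"
    using below_other[OF cov] by blast
  then obtain b where b: "b \<in> below v" "b \<noteq> a"
    using below_other[OF cov, of a] by (auto simp: below_def)
  have "card {a, b} \<le> card (below v)"
    using a b \<open>finite (below v)\<close> by (intro card_mono) auto
  then show ?thesis
    using b by simp
qed

section \<open>Labelings with the top label at a fixed minimal element\<close>

context
  fixes x :: 'p
  assumes x: "x \<in> minimal_elements P rP"
begin

lemma minimal_carrier: "x \<in> P"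
  using x by (simp add: minimal_elements_def)

definition ending_in :: "'p set \<Rightarrow> ('p \<Rightarrow> nat) set" where
  "ending_in S = {L \<in> labelings P. L x = card P \<and> P.final_place L \<in> S}"

text \<open>A final place in the fiber of \<open>v\<close> would have all of \<open>below v\<close>
  under it, including some element other than \<open>x\<close>; but only \<open>x\<close> can be
  under it.\<close>

lemma ending_in_weakly_below_eq_below:
  assumes cov: "covers Q rQ v w"
  shows "ending_in (weakly_below v) = ending_in (below v)"
proof -
  have "P.final_place L \<in> below v"
    if L: "L \<in> labelings P" "L x = card P" "P.final_place L \<in> weakly_below v" for L
  proof (rule ccontr)
    assume "P.final_place L \<notin> below v"
    then have "\<phi> (P.final_place L) = v"
      using L by (auto simp: weakly_below_iff below_def)
    moreover obtain d where "d \<in> below v" "d \<noteq> x"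
      using below_other[OF cov minimal_carrier] by blast
    ultimately show False
      using P.below_final_place[OF two L(1) x L(2)] less_of_map_less L(3)
      by (auto simp: below_def weakly_below_iff)
  qed
  then show ?thesis
    by (auto simp: ending_in_def weakly_below_iff below_def)
qed

lemma card_ending_in_covers:
  assumes cov: "covers Q rQ v w" and "x \<in> weakly_below w"
  shows "real (card (ending_in (weakly_below w))) = real (card (ending_in (weakly_below v))) *
    ((real (card (weakly_below w)) - 1) / (real (card (below v)) - 1))"
proof -
  interpret M: promotion_module P rP "below v" "weakly_below w"
    by (rule module[OF cov])
  have "card (ending_in (weakly_below w)) * (card (below v) - 1) =
      card (ending_in (weakly_below v)) * (card (weakly_below w) - 1)"
    unfolding ending_in_weakly_below_eq_below[OF cov]
    using M.card_final_place[OF two x assms(2)] by (simp add: ending_in_def)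
  then have "real (card (ending_in (weakly_below w))) * real (card (below v) - 1) =
      real (card (ending_in (weakly_below v))) * real (card (weakly_below w) - 1)"
    by (metis of_nat_mult)
  moreover have "1 \<le> card (weakly_below w)"
    using assms(2) P.finite_carrier by (auto simp: Suc_le_eq card_gt_0_iff weakly_below_def)
  ultimately show ?thesis
    using card_below_ge[OF cov] by (simp add: field_simps of_nat_diff)
qed

lemma weakly_below_mono: "covers Q rQ v w \<Longrightarrow> weakly_below w \<subseteq> weakly_below v"
  using Q.less_trans by (auto simp: weakly_below_iff covers_def)

text \<open>The one-edge factors telescope. Membership of \<open>x\<close> is carried along because
  each further edge needs it.\<close>

lemma card_ending_in_path:
  fixes m :: nat
  assumes "\<forall>j\<in>{1..m}. covers Q rQ (u j) (u (j - 1))" and "x \<in> weakly_below (u 0)"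
  shows "x \<in> weakly_below (u m) \<and> real (card (ending_in (weakly_below (u 0)))) = real (card (ending_in (weakly_below (u m)))) *
    (\<Prod>j=1..m. (real (card (weakly_below (u (j - 1)))) - 1) / (real (card (below (u j))) - 1))"
  using assms(1)
proof (induction m)
  case 0
  then show ?case
    using assms(2) by simp
next
  case (Suc m)
  then have cov: "covers Q rQ (u (Suc m)) (u m)"
    by (metis Suc_leI atLeastAtMost_iff diff_Suc_1 le_refl zero_less_Suc One_nat_def)
  have IH: "x \<in> weakly_below (u m)" "real (card (ending_in (weakly_below (u 0)))) =
      real (card (ending_in (weakly_below (u m)))) *
      (\<Prod>j=1..m. (real (card (weakly_below (u (j - 1)))) - 1) / (real (card (below (u j))) - 1))"
    using Suc by auto
  show ?case
    using IH weakly_below_mono[OF cov] card_ending_in_covers[OF cov IH(1)] by (auto simp: algebra_simps)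
qed

text \<open>At the leaf, \<open>ending_in\<close> gives the tangled labelings with top label at
  \<open>x\<close>; at the root it gives all labelings with top label at \<open>x\<close>, of which
  there are \<open>fact (card P - 1)\<close>.\<close>

lemma card_tangled_top:
  assumes path: "path_to_root Q rQ (\<phi> x) u m"
  shows "real (card {L. tangled P rP L \<and> L x = card P}) = fact (card P - 1) *
    (\<Prod>j=1..m. (real (card (weakly_below (u (j - 1)))) - 1) / (real (card (below (u j))) - 1))"
proof -
  have u0: "u 0 = \<phi> x" and cov: "\<forall>j\<in>{1..m}. covers Q rQ (u j) (u (j - 1))"
    and root: "maximal_elements Q rQ = {u m}"
    using path by (auto simp: path_to_root_def is_root_def)
  \<comment> \<open>By finiteness every element of the fiber is weakly above a minimal one; there is
    only one, and it is \<open>x\<close>.\<close>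
  have least: "y = x \<or> strict_below rP x y" if y: "y \<in> P" "\<phi> y = \<phi> x" for y
  proof -
    have "fiber P \<phi> (\<phi> x) \<subseteq> P" "y \<in> fiber P \<phi> (\<phi> x)"
      using y by (auto simp: fiber_def)
    then obtain z where z: "z \<in> fiber P \<phi> (\<phi> x)" "z = y \<or> strict_below rP z y"
      "\<And>w. w \<in> fiber P \<phi> (\<phi> x) \<Longrightarrow> \<not> strict_below rP w z"
      using P.ex_minimal_below by blast
    have "z \<in> minimal_elements (fiber P \<phi> (\<phi> x)) rP"
      using z by (auto simp: minimal_elements_def)
    moreover have "x \<in> minimal_elements (fiber P \<phi> (\<phi> x)) rP"
      using x by (auto simp: minimal_elements_def fiber_def)
    ultimately have "z = x"
      using inflation map_carrier[OF minimal_carrier] unfolding inflation_def by blast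
    then show ?thesis
      using z by blast
  qed
  have minQ: "\<not> strict_below rQ v (\<phi> x)" for v
  proof
    assume v: "strict_below rQ v (\<phi> x)"
    then obtain p where "p \<in> P" "\<phi> p = v"
      using fiber_nonempty Q.less_carrier by blast
    then show False
      using v x less_of_map_less minimal_carrier by (auto simp: minimal_elements_def)
  qed
  have x0: "x \<in> weakly_below (u 0)"
    using minimal_carrier by (simp add: u0 weakly_below_iff)
  have "{L. tangled P rP L \<and> L x = card P} = ending_in (weakly_below (u 0))"
  proof (intro equalityI subsetI)
    fix L assume "L \<in> {L. tangled P rP L \<and> L x = card P}"
    then have t: "tangled P rP L" and L: "L \<in> labelings P" "L x = card P"
      by (auto simp: tangled_def)
    let ?q = "P.final_place L"
    have q: "strict_below rP x ?q"
      using t P.tangled_iff_below_final_place[OF two L(1) x L(2)] by simp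
    \<comment> \<open>Otherwise a cover \<open>c\<close> of \<open>\<phi> x\<close> is weakly below
      \<open>\<phi> ?q\<close>, and \<open>below c\<close> puts an element other than
      \<open>x\<close> under the final place.\<close>
    have "\<not> strict_below rQ (\<phi> x) (\<phi> ?q)"
    proof
      assume lt: "strict_below rQ (\<phi> x) (\<phi> ?q)"
      then obtain c where c: "covers Q rQ c (\<phi> x)" "c = \<phi> ?q \<or> strict_below rQ c (\<phi> ?q)"
        using Q.ex_cover_below by blast
      obtain d where "d \<in> below c" "d \<noteq> x"
        using below_other[OF c(1) minimal_carrier] by blast
      moreover from this have "strict_below rP d ?q"
        using c(2) Q.less_trans less_of_map_less P.less_carrier[OF q] by (auto simp: below_def)
      ultimately show False
        using P.below_final_place[OF two L(1) x L(2)] by blast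
    qed
    then have "?q \<in> weakly_below (u 0)"
      using map_less[OF q] P.less_carrier[OF q] by (auto simp: u0 weakly_below_iff)
    then show "L \<in> ending_in (weakly_below (u 0))"
      using L by (simp add: ending_in_def)
  next
    fix L assume "L \<in> ending_in (weakly_below (u 0))"
    then have L: "L \<in> labelings P" "L x = card P" and q: "P.final_place L \<in> weakly_below (u 0)"
      by (auto simp: ending_in_def)
    have "strict_below rP x (P.final_place L)"
      using least q minQ P.final_place_neq_minimal[OF two L(1) x L(2)]
      by (auto simp: u0 weakly_below_iff)
    then show "L \<in> {L. tangled P rP L \<and> L x = card P}"
      using P.tangled_iff_below_final_place[OF two L(1) x L(2)] L by simp
  qed
  moreover have "ending_in (weakly_below (u m)) = {L \<in> labelings P. L x = card P}"
  proof -
    have "p \<in> weakly_below (u m)" if p: "p \<in> P" for p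
    proof -
      obtain v where v: "v \<in> Q" "\<phi> p = v \<or> strict_below rQ (\<phi> p) v"
        "\<And>z. z \<in> Q \<Longrightarrow> \<not> strict_below rQ v z"
        using Q.ex_maximal_above[OF order_refl map_carrier[OF p]] by blast
      then have "v \<in> maximal_elements Q rQ"
        by (simp add: maximal_elements_def)
      then show ?thesis
        using v root p by (auto simp: weakly_below_iff)
    qed
    then show ?thesis
      using P.final_place(1)[OF two] by (auto simp: ending_in_def)
  qed
  ultimately show ?thesis
    using card_ending_in_path[OF cov x0] card_labelings_fixed_top[OF P.finite_carrier minimal_carrier]
    by simp
qed

end

section \<open>Summation over the leaves\<close>

definition fiber_bottom :: "'q \<Rightarrow> 'p" where
  "fiber_bottom v = (THE x. x \<in> minimal_elements (fiber P \<phi> v) rP)"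

lemma fiber_bottom:
  assumes "v \<in> minimal_elements Q rQ"
  shows "fiber_bottom v \<in> minimal_elements P rP" "\<phi> (fiber_bottom v) = v"
proof -
  have "\<exists>!x. x \<in> minimal_elements (fiber P \<phi> v) rP"
    using assms inflation by (auto simp: minimal_elements_def inflation_def)
  then have b: "fiber_bottom v \<in> minimal_elements (fiber P \<phi> v) rP"
    unfolding fiber_bottom_def by (rule theI')
  then show v: "\<phi> (fiber_bottom v) = v"
    by (simp add: minimal_elements_def fiber_def)
  have "\<not> strict_below rP y (fiber_bottom v)" if "y \<in> P" for y
    using that b assms map_less[of y "fiber_bottom v"] map_carrier[OF that]
    by (auto simp: minimal_elements_def fiber_def)
  then show "fiber_bottom v \<in> minimal_elements P rP"
    using b by (simp add: minimal_elements_def fiber_def)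
qed

text \<open>Together with \<open>fiber_bottom\<close>, this gives mutually inverse maps between the
  leaves of \<open>Q\<close> and the minimal elements of \<open>P\<close>.\<close>

lemma minimal_is_fiber_bottom:
  assumes x: "x \<in> minimal_elements P rP"
  shows "\<phi> x \<in> minimal_elements Q rQ" "fiber_bottom (\<phi> x) = x"
proof -
  have xP: "x \<in> P"
    using x by (simp add: minimal_elements_def)
  have "\<not> strict_below rQ v (\<phi> x)" if "v \<in> Q" for v
    using fiber_nonempty[OF that] x xP less_of_map_less by (auto simp: minimal_elements_def)
  then show "\<phi> x \<in> minimal_elements Q rQ"
    using map_carrier[OF xP] by (simp add: minimal_elements_def)
  have "\<exists>!y. y \<in> minimal_elements (fiber P \<phi> (\<phi> x)) rP"
    using map_carrier[OF xP] inflation by (simp add: inflation_def)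
  moreover have "x \<in> minimal_elements (fiber P \<phi> (\<phi> x)) rP"
    using x by (auto simp: minimal_elements_def fiber_def)
  ultimately show "fiber_bottom (\<phi> x) = x"
    unfolding fiber_bottom_def by (rule the1_equality)
qed

text \<open>The top label of a tangled labeling sits at a minimal element of \<open>P\<close>, hence
  at the bottom of the fiber of exactly one leaf.\<close>

lemma card_tangled:
  "card {L. tangled P rP L} =
    (\<Sum>v\<in>minimal_elements Q rQ. card {L. tangled P rP L \<and> L (fiber_bottom v) = card P})"
proof -
  let ?T = "\<lambda>v. {L. tangled P rP L \<and> L (fiber_bottom v) = card P}"
  have "{L. tangled P rP L} = (\<Union>v\<in>minimal_elements Q rQ. ?T v)"
    using P.tangled_top_minimal[OF two] minimal_is_fiber_bottom by (auto; metis)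
  moreover have "finite (minimal_elements Q rQ)"
    using Q.finite_carrier by (simp add: minimal_elements_def)
  moreover have "finite (?T v)" for v
    using finite_labelings[OF P.finite_carrier] by (rule rev_finite_subset) (auto simp: tangled_def)
  moreover have "?T v \<inter> ?T w = {}"
    if "v \<in> minimal_elements Q rQ" "w \<in> minimal_elements Q rQ" "v \<noteq> w" for v w
  proof -
    have "fiber_bottom v \<noteq> fiber_bottom w" "fiber_bottom v \<in> P" "fiber_bottom w \<in> P"
      using that fiber_bottom by (metis, (auto simp: minimal_elements_def)+)
    then have "L (fiber_bottom v) \<noteq> L (fiber_bottom w)" if "tangled P rP L" for L
      using that P.labeling_inj by (metis tangled_def)
    then show ?thesis
      by auto metis
  qed
  ultimately show ?thesis
    by (simp add: card_UN_disjoint)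
qed

end

theorem theorem3p5:
  fixes P :: "'p set" and rP :: "'p rel"
    and Q :: "'q set" and rQ :: "'q rel"
    and \<phi> :: "'p \<Rightarrow> 'q"
    and s n :: nat and l :: "nat \<Rightarrow> 'q"
    and u :: "nat \<Rightarrow> nat \<Rightarrow> 'q" and \<omega> :: "nat \<Rightarrow> nat"
  assumes "rooted_tree_poset Q rQ" and "reduced_poset Q rQ"
    and "inflation P rP Q rQ \<phi>"
    and "card P \<ge> 2"
    and "bij_betw l {1..s} (minimal_elements Q rQ)"
    and "\<And>i. i \<in> {1..s} \<Longrightarrow> path_to_root Q rQ (l i) (u i) (\<omega> i)"
    and "n = (\<Sum>v\<in>Q. card (fiber P \<phi> v))"
  shows "n = card P \<and>
    real (card {L. tangled P rP L}) =
      fact (n - 1) * (\<Sum>i=1..s. \<Prod>j=1..\<omega> i.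
        (real (b_num P Q rQ \<phi> u i j) - 1) / (real (c_num P Q rQ \<phi> u i j) - 1))"
proof -
  interpret inflated_tree P rP Q rQ \<phi>
    using assms by unfold_locales
  have "{p \<in> P. \<phi> p \<in> Q} = P"
    using map_carrier by blast
  then have n: "n = card P"
    using card_vimage[of Q] assms(7) by simp
  have "real (card {L. tangled P rP L \<and> L (fiber_bottom (l i)) = card P}) =
      fact (n - 1) * (\<Prod>j=1..\<omega> i.
        (real (b_num P Q rQ \<phi> u i j) - 1) / (real (c_num P Q rQ \<phi> u i j) - 1))"
    if i: "i \<in> {1..s}" for i
  proof -
    have "l i \<in> minimal_elements Q rQ"
      using assms(5) i by (auto simp: bij_betw_def)
    note f = fiber_bottom[OF this]
    show ?thesis
      using card_tangled_top[OF f(1), of "u i" "\<omega> i"] assms(6)[OF i] f(2)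
      by (simp add: n b_num_def c_num_def card_weakly_below card_below)
  qed
  then have "real (card {L. tangled P rP L}) = (\<Sum>i=1..s. fact (n - 1) * (\<Prod>j=1..\<omega> i.
      (real (b_num P Q rQ \<phi> u i j) - 1) / (real (c_num P Q rQ \<phi> u i j) - 1)))"
    unfolding card_tangled of_nat_sum sum.reindex_bij_betw[OF assms(5), symmetric]
    by (intro sum.cong) auto
  then show ?thesis
    using n by (simp add: sum_distrib_left)
qed

end
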